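(* Let $X$ be a minimal shift space on a finite alphabet $A$ with an invariant measure $\mu$ and $\varphi\colon A^*\to G$ be a (monoid) morphism onto a finite group $G$ with uniform probability measure $\nu$. (i) If $\nu\times\mu$ restricts to an ergodic measure on a closed invariant subset $Y$ of $G\rtimes_\varphi X$, then $Y$ must be minimal. (ii) If $\nu\times\mu$ restricts to an ergodic measure on any (i.e. at least one) minimal closed invariant subset of $G\rtimes_\varphi X$, then it must restrict to an ergodic measure on each of them. (iii) If $\nu\times\mu$ is ergodic, then $G\rtimes_\varphi X$ must be minimal.
   Context: A shift space on a finite alphabet $A$ is a nonempty closed subset $X\subseteq A^{\mathbb Z}$ invariant under the shift map $S((x_n)_n)=(x_{n+1})_n$, such that every letter of $A$ occurs in some element of $X$; it is minimal if it has no proper nonempty closed shift-invariant subset. Invariant measures are shift-invariant Borel probability measures. The skew product $G\rtimes_\varphi X$ is the dynamical system $(G\times X,T_\varphi)$, $G$ discrete, with $T_\varphi(g,x)=(g\varphi(x_0),Sx)$. A nonempty closed $T_\varphi$-invariant subset $Y$ (or the whole skew product) is minimal if it has no proper nonempty closed $T_\varphi$-invariant subset. "$\nu\times\mu$ restricts to an ergodic measure on $Y$" means that $(\nu\times\mu)(Y)>0$ and the normalized restriction of $\nu\times\mu$ to $Y$ is ergodic for $T_\varphi$. *)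

theory Defs
  imports "HOL-Probability.Probability" "HOL-Algebra.Group"
begin

definition closed_invariant :: "'a topology \<Rightarrow> ('a \<Rightarrow> 'a) \<Rightarrow> 'a set \<Rightarrow> bool" where
  "closed_invariant \<T> f Y \<longleftrightarrow> closedin \<T> Y \<and> f ` Y = Y"

definition minimal_closed_invariant :: "'a topology \<Rightarrow> ('a \<Rightarrow> 'a) \<Rightarrow> 'a set \<Rightarrow> bool" where
  "minimal_closed_invariant \<T> f Y \<longleftrightarrow>
     closed_invariant \<T> f Y \<and> Y \<noteq> {} \<and>
     (\<forall>Z. closed_invariant \<T> f Z \<and> Z \<noteq> {} \<and> Z \<subseteq> Y \<longrightarrow> Z = Y)"

definition borel_of :: "'a topology \<Rightarrow> 'a measure" where
  "borel_of \<T> = sigma (topspace \<T>) {U. openin \<T> U}"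

definition invariant_measure :: "'a measure \<Rightarrow> ('a \<Rightarrow> 'a) \<Rightarrow> bool" where
  "invariant_measure M f \<longleftrightarrow> prob_space M \<and> f \<in> M \<rightarrow>\<^sub>M M \<and> distr M M f = M"

definition ergodic_measure :: "'a measure \<Rightarrow> ('a \<Rightarrow> 'a) \<Rightarrow> bool" where
  "ergodic_measure M f \<longleftrightarrow>
     invariant_measure M f \<and>
     (\<forall>B\<in>sets M. f -` B \<inter> space M = B \<longrightarrow> measure M B = 0 \<or> measure M B = 1)"

definition restricts_to_ergodic :: "'a measure \<Rightarrow> ('a \<Rightarrow> 'a) \<Rightarrow> 'a set \<Rightarrow> bool" where
  "restricts_to_ergodic M f Y \<longleftrightarrow>
     emeasure M Y > 0 \<and>
     ergodic_measure (scale_measure (1 / emeasure M Y) (restrict_space M Y)) f"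

definition full_shift :: "'a set \<Rightarrow> (int \<Rightarrow> 'a) topology" where
  "full_shift A = product_topology (\<lambda>_. discrete_topology A) UNIV"

definition shift_map :: "(int \<Rightarrow> 'a) \<Rightarrow> int \<Rightarrow> 'a" where
  "shift_map x = (\<lambda>n. x (n + 1))"

definition shift_space :: "'a set \<Rightarrow> (int \<Rightarrow> 'a) set \<Rightarrow> bool" where
  "shift_space A X \<longleftrightarrow>
     X \<noteq> {} \<and> closed_invariant (full_shift A) shift_map X \<and>
     (\<forall>a\<in>A. \<exists>x\<in>X. \<exists>n. x n = a)"

definition minimal_shift_space :: "'a set \<Rightarrow> (int \<Rightarrow> 'a) set \<Rightarrow> bool" where
  "minimal_shift_space A X \<longleftrightarrow>
     shift_space A X \<and> minimal_closed_invariant (full_shift A) shift_map X"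

definition free_monoid :: "'a set \<Rightarrow> 'a list monoid" where
  "free_monoid A = \<lparr>carrier = lists A, monoid.mult = (@), one = []\<rparr>"

definition skew_topology ::
    "('g, 'b) monoid_scheme \<Rightarrow> 'a set \<Rightarrow> (int \<Rightarrow> 'a) set \<Rightarrow> ('g \<times> (int \<Rightarrow> 'a)) topology" where
  "skew_topology G A X =
     prod_topology (discrete_topology (carrier G)) (subtopology (full_shift A) X)"

definition skew_map ::
    "('g, 'b) monoid_scheme \<Rightarrow> ('a list \<Rightarrow> 'g) \<Rightarrow> 'g \<times> (int \<Rightarrow> 'a) \<Rightarrow> 'g \<times> (int \<Rightarrow> 'a)" where
  "skew_map G \<phi> = (\<lambda>(g, x). (g \<otimes>\<^bsub>G\<^esub> \<phi> [x 0], shift_map x))"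

text \<open>As \<open>carrier G\<close> is finite and discrete, the product sigma-algebra below is the Borel
  sigma-algebra of \<open>skew_topology G A X\<close>.\<close>

definition skew_measure ::
    "('g, 'b) monoid_scheme \<Rightarrow> (int \<Rightarrow> 'a) measure \<Rightarrow> ('g \<times> (int \<Rightarrow> 'a)) measure" where
  "skew_measure G \<mu> = uniform_count_measure (carrier G) \<Otimes>\<^sub>M \<mu>"

end

theory Submission
  imports Defs
begin

text \<open>For a closed invariant subset \<open>Z\<close> of the skew product, the number of points of \<open>Z\<close> above
  \<open>x \<in> X\<close> is upper semicontinuous and shift invariant in \<open>x\<close>, so minimality of \<open>X\<close> makes it a
  constant \<open>k\<close>, and \<open>(\<nu> \<times> \<mu>)(Z) = k / |G|\<close>. Hence nested closed invariant sets of equal measure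
  coincide, which gives (i) and (iii). The left translations of \<open>G\<close> commute with the skew map,
  preserve \<open>\<nu> \<times> \<mu>\<close> and act transitively on the minimal sets, which gives (ii).\<close>

section \<open>Transport of invariance and ergodicity along a measure-preserving map with a
  measurable section\<close>

lemma invariant_measure_transfer:
  assumes N: "invariant_measure N f"
    and L: "L \<in> N \<rightarrow>\<^sub>M N'" and K: "K \<in> N' \<rightarrow>\<^sub>M N"
    and LK: "\<And>y. y \<in> space N' \<Longrightarrow> L (K y) = y"
    and comm: "\<And>x. x \<in> space N \<Longrightarrow> f (L x) = L (f x)"
    and distr: "distr N N' L = N'"
  shows "invariant_measure N' f"
proof -
  have f: "f \<in> N \<rightarrow>\<^sub>M N" and fN: "distr N N f = N" and "prob_space N"
    using N by (auto simp: invariant_measure_def)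
  then interpret prob_space N by simp
  \<comment> \<open>The section \<open>K\<close> exhibits \<open>f\<close> on \<open>N'\<close> as a
    composite of measurable maps, which makes it measurable there.\<close>
  have "f y = (L \<circ> (f \<circ> K)) y" if "y \<in> space N'" for y
    using comm[OF measurable_space[OF K that]] LK[OF that] by simp
  then have f': "f \<in> N' \<rightarrow>\<^sub>M N'"
    using measurable_comp[OF measurable_comp[OF K f] L] measurable_cong[of N' f] by metis
  have "distr N' N' f = distr (distr N N' L) N' f"
    by (simp add: distr)
  also have "\<dots> = distr N N' (f \<circ> L)"
    by (rule distr_distr[OF f' L])
  also have "\<dots> = distr N N' (L \<circ> f)"
    by (rule distr_cong) (auto simp: comm)
  also have "\<dots> = distr (distr N N f) N' L"
    by (rule distr_distr[OF L f, symmetric])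
  also have "\<dots> = N'"
    by (simp add: fN distr)
  finally show ?thesis
    using f' prob_space_distr[OF L] by (simp add: invariant_measure_def distr)
qed

text \<open>Since \<open>L\<close> intertwines the two actions of \<open>f\<close>, the preimage
  under \<open>L\<close> of an invariant set is invariant; since \<open>L\<close> carries
  \<open>N\<close> to \<open>N'\<close>, it has the same measure. So the zero-one law on
  \<open>N\<close> passes to \<open>N'\<close>.\<close>

lemma ergodic_measure_transfer:
  assumes N: "ergodic_measure N f"
    and L: "L \<in> N \<rightarrow>\<^sub>M N'" and K: "K \<in> N' \<rightarrow>\<^sub>M N"
    and LK: "\<And>y. y \<in> space N' \<Longrightarrow> L (K y) = y"
    and comm: "\<And>x. x \<in> space N \<Longrightarrow> f (L x) = L (f x)"
    and distr: "distr N N' L = N'"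
  shows "ergodic_measure N' f"
  unfolding ergodic_measure_def
proof (intro conjI ballI impI)
  have inv: "invariant_measure N f" using N by (simp add: ergodic_measure_def)
  then have f: "f \<in> N \<rightarrow>\<^sub>M N" by (simp add: invariant_measure_def)
  show "invariant_measure N' f"
    by (rule invariant_measure_transfer[OF inv L K LK comm distr])
  fix B assume B: "B \<in> sets N'" and fB: "f -` B \<inter> space N' = B"
  let ?C = "L -` B \<inter> space N"
  have "x \<in> f -` ?C \<longleftrightarrow> x \<in> ?C" if x: "x \<in> space N" for x
  proof -
    have "x \<in> f -` ?C \<longleftrightarrow> L (f x) \<in> B"
      using measurable_space[OF f x] by auto
    also have "\<dots> \<longleftrightarrow> f (L x) \<in> B"
      by (simp add: comm x)
    also have "\<dots> \<longleftrightarrow> L x \<in> B"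
      using fB measurable_space[OF L x] by blast
    finally show ?thesis using x by simp
  qed
  then have "f -` ?C \<inter> space N = ?C" by blast
  moreover have "?C \<in> sets N" using L B by (rule measurable_sets)
  ultimately have "measure N ?C = 0 \<or> measure N ?C = 1"
    using N by (simp add: ergodic_measure_def)
  then show "measure N' B = 0 \<or> measure N' B = 1"
    using measure_distr[OF L B] by (simp add: distr)
qed

text \<open>As \<open>L\<close> preserves \<open>M\<close> and pulls \<open>Y'\<close> back to
  \<open>Y\<close>, both sets have the same measure and hence the same normalizing factor. The maps
  \<open>L\<close> and \<open>K\<close> restrict to maps between \<open>Y\<close> and
  \<open>Y'\<close>, so ergodicity of the normalized restriction is transported.\<close>

lemma restricts_to_ergodic_transfer:
  assumes Y: "restricts_to_ergodic M f Y"
    and meas: "Y \<in> sets M" "Y' \<in> sets M"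
    and L: "L \<in> M \<rightarrow>\<^sub>M M" and K: "K \<in> M \<rightarrow>\<^sub>M M"
    and LY: "L -` Y' \<inter> space M = Y"
    and LK: "\<And>y. y \<in> space M \<Longrightarrow> L (K y) = y"
    and comm: "\<And>x. x \<in> space M \<Longrightarrow> f (L x) = L (f x)"
    and distr: "distr M M L = M"
  shows "restricts_to_ergodic M f Y'"
proof -
  have preserve: "emeasure M (L -` B \<inter> space M) = emeasure M B" if "B \<in> sets M" for B
    using emeasure_distr[OF L that] by (simp add: distr)
  have eq: "emeasure M Y' = emeasure M Y"
    using preserve[OF meas(2)] LY by simp
  let ?N = "\<lambda>Y. scale_measure (1 / emeasure M Y) (restrict_space M Y)"
  have sub: "Y \<subseteq> space M" "Y' \<subseteq> space M"
    using meas sets.sets_into_space by blast+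
  have spN: "space (?N Z) = Z" if "Z \<subseteq> space M" for Z
    using that by (auto simp: space_scale_measure space_restrict_space)
  have "ergodic_measure (?N Y') f"
  proof (rule ergodic_measure_transfer)
    show "ergodic_measure (?N Y) f"
      using Y by (simp add: restricts_to_ergodic_def)
    have "L \<in> restrict_space M Y \<rightarrow>\<^sub>M restrict_space M Y'"
      using LY by (intro measurable_restrict_space3 L) auto
    then show L': "L \<in> ?N Y \<rightarrow>\<^sub>M ?N Y'"
      by (simp cong: measurable_cong_sets)
    \<comment> \<open>The point \<open>K y\<close> is sent by \<open>L\<close> to \<open>y\<close>,
      so it lies in the preimage of \<open>Y'\<close>, which is \<open>Y\<close>.\<close>
    have "K y \<in> Y" if "y \<in> Y'" for y
      using that sub LK[of y] measurable_space[OF K, of y] LY by auto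
    then have "K \<in> restrict_space M Y' \<rightarrow>\<^sub>M restrict_space M Y"
      by (intro measurable_restrict_space3 K) auto
    then show "K \<in> ?N Y' \<rightarrow>\<^sub>M ?N Y"
      by (simp cong: measurable_cong_sets)
    show "L (K y) = y" if "y \<in> space (?N Y')" for y
      using that spN sub LK by auto
    show "f (L x) = L (f x)" if "x \<in> space (?N Y)" for x
      using that spN sub comm by auto
    show "distr (?N Y) (?N Y') L = ?N Y'"
    proof (rule measure_eqI)
      fix B assume "B \<in> sets (distr (?N Y) (?N Y') L)"
      then have B': "B \<in> sets (?N Y')" by simp
      then have B: "B \<in> sets M" "B \<subseteq> Y'"
        using meas by (auto simp: sets_restrict_space_iff)
      have pre: "L -` B \<inter> Y = L -` B \<inter> space M"
        using B LY by auto
      have "emeasure (distr (?N Y) (?N Y') L) B = emeasure (?N Y) (L -` B \<inter> space M)"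
        by (simp only: emeasure_distr[OF L' B'] spN[OF sub(1)] pre)
      also have "\<dots> = emeasure (?N Y') B"
        using B meas pre eq preserve[OF B(1)] by (simp add: emeasure_restrict_space flip: pre)
      finally show "emeasure (distr (?N Y) (?N Y') L) B = emeasure (?N Y') B" .
    qed simp
  qed
  then show ?thesis
    using Y eq by (simp add: restricts_to_ergodic_def)
qed

text \<open>The zero-one law for the normalized restriction says that the quotient of the two
  measures is 0 or 1. The normalization is undone because the measure of \<open>Y\<close> is
  positive and finite.\<close>

lemma ergodic_restriction_full_or_null:
  assumes Y: "restricts_to_ergodic M f Y" and "finite_measure M"
    and meas: "Y \<in> sets M" "Z \<in> sets M" and "Z \<subseteq> Y" and inv: "f -` Z \<inter> Y = Z"
  shows "emeasure M Z = 0 \<or> emeasure M Z = emeasure M Y"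
proof -
  interpret finite_measure M by fact
  let ?N = "scale_measure (1 / emeasure M Y) (restrict_space M Y)"
  have pos: "emeasure M Y > 0" and erg: "ergodic_measure ?N f"
    using Y by (auto simp: restricts_to_ergodic_def)
  have Z: "Z \<in> sets ?N"
    using assms by (auto simp: sets_restrict_space_iff)
  have "space ?N = Y"
    using sets.sets_into_space[OF meas(1)] by (auto simp: space_scale_measure space_restrict_space)
  then have "measure ?N Z = 0 \<or> measure ?N Z = 1"
    using erg Z inv by (auto simp: ergodic_measure_def)
  moreover interpret N: prob_space ?N
    using erg by (simp add: ergodic_measure_def invariant_measure_def)
  have "emeasure ?N Z = emeasure M Z / emeasure M Y"
    using meas \<open>Z \<subseteq> Y\<close> by (simp add: emeasure_restrict_space ennreal_divide_times)
  ultimately have "emeasure M Z / emeasure M Y = 0 \<or> emeasure M Z / emeasure M Y = 1"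
    by (metis N.emeasure_eq_measure ennreal_0 ennreal_1)
  then show ?thesis
    using pos emeasure_finite[of Y]
    by (metis divide_eq_1_ennreal ennreal_divide_eq_0_iff infinity_ennreal_def)
qed

section \<open>Borel sets and the two-sided shift\<close>

lemma closed_in_sets_borel_of:
  assumes "closedin \<T> C"
  shows "C \<in> sets (borel_of \<T>)"
proof -
  have "topspace \<T> - C \<in> sets (borel_of \<T>)"
    using assms openin_subset by (auto simp: borel_of_def closedin_def)
  moreover have "space (borel_of \<T>) = topspace \<T>"
    using openin_subset by (auto simp: borel_of_def space_measure_of_conv)
  ultimately have "topspace \<T> - (topspace \<T> - C) \<in> sets (borel_of \<T>)"
    by (metis sets.compl_sets)
  then show ?thesis
    using closedin_subset[OF assms] by (simp add: double_diff)
qed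

lemma inj_shift_map: "inj shift_map"
proof (rule injI, rule ext)
  fix x y :: "int \<Rightarrow> 'a" and n
  assume "shift_map x = shift_map y"
  then have "shift_map x (n - 1) = shift_map y (n - 1)" by simp
  then show "x n = y n" by (simp add: shift_map_def)
qed

section \<open>The skew product over a minimal shift space and its closed invariant sets\<close>

definition fiber :: "('g \<times> 'x) set \<Rightarrow> 'x \<Rightarrow> 'g set" where
  "fiber Z x = {g. (g, x) \<in> Z}"

text \<open>The symmetries of the skew product: the skew map multiplies the group coordinate on the
  right, so by associativity it commutes with multiplication on the left.\<close>

definition left_translation :: "('g, 'b) monoid_scheme \<Rightarrow> 'g \<Rightarrow> 'g \<times> 'x \<Rightarrow> 'g \<times> 'x" where
  "left_translation G h = (\<lambda>(g, x). (h \<otimes>\<^bsub>G\<^esub> g, x))"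

locale minimal_skew_product = group G for G :: "('g, 'b) monoid_scheme" (structure) +
  fixes A :: "'a set" and X :: "(int \<Rightarrow> 'a) set" and \<phi> :: "'a list \<Rightarrow> 'g"
    and \<mu> :: "(int \<Rightarrow> 'a) measure"
  assumes finite_carrier: "finite (carrier G)"
    and minimal: "minimal_closed_invariant (full_shift A) shift_map X"
    and letter_closed: "a \<in> A \<Longrightarrow> \<phi> [a] \<in> carrier G"
    and sets_\<mu>: "sets \<mu> = sets (borel_of (subtopology (full_shift A) X))"
    and invariant_\<mu>: "invariant_measure \<mu> shift_map"
begin

abbreviation "T \<equiv> skew_map G \<phi>"
abbreviation "\<T> \<equiv> skew_topology G A X"
abbreviation "m \<equiv> skew_measure G \<mu>"
abbreviation "L \<equiv> left_translation G"

sublocale \<mu>: prob_space \<mu>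
  using invariant_\<mu> by (simp add: invariant_measure_def)

lemma closed_X: "closedin (full_shift A) X" and shift_X: "shift_map ` X = X" and X_nonempty: "X \<noteq> {}"
  using minimal by (auto simp: minimal_closed_invariant_def closed_invariant_def)

lemma minimal_X:
  "closedin (full_shift A) Z \<Longrightarrow> shift_map ` Z = Z \<Longrightarrow> Z \<noteq> {} \<Longrightarrow> Z \<subseteq> X \<Longrightarrow> Z = X"
  using minimal by (auto simp: minimal_closed_invariant_def closed_invariant_def)

lemma X_subset: "X \<subseteq> topspace (full_shift A)"
  using closedin_subset[OF closed_X] .

lemma topspace_subtopology_X: "topspace (subtopology (full_shift A) X) = X"
  using X_subset by (auto simp: topspace_subtopology)

lemma topspace_skew: "topspace \<T> = carrier G \<times> X"
  using topspace_subtopology_X by (simp add: skew_topology_def)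

lemma space_\<mu>: "space \<mu> = X"
proof -
  have "space \<mu> = space (borel_of (subtopology (full_shift A) X))"
    by (rule sets_eq_imp_space_eq[OF sets_\<mu>])
  also have "\<dots> = X"
    using openin_subset topspace_subtopology_X
    by (fastforce simp: borel_of_def space_measure_of_conv)
  finally show ?thesis .
qed

lemma letter_in_carrier: "x \<in> X \<Longrightarrow> \<phi> [x n] \<in> carrier G"
  using X_subset letter_closed by (auto simp: full_shift_def)

lemma T_simp: "T (g, x) = (g \<otimes> \<phi> [x 0], shift_map x)"
  by (simp add: skew_map_def)

lemma L_simp: "L h (g, x) = (h \<otimes> g, x)"
  by (simp add: left_translation_def)

lemma T_inj: "inj_on T (carrier G \<times> X)"
proof (rule inj_onI)
  fix p q assume "p \<in> carrier G \<times> X" "q \<in> carrier G \<times> X" "T p = T q"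
  moreover obtain g x h y where "p = (g, x)" "q = (h, y)" by (cases p, cases q)
  ultimately show "p = q"
    using injD[OF inj_shift_map, of x y] letter_in_carrier[of x 0] by (auto simp: T_simp)
qed

lemma T_surj: "T ` (carrier G \<times> X) = carrier G \<times> X"
proof (intro equalityI subsetI)
  fix p assume "p \<in> T ` (carrier G \<times> X)"
  then show "p \<in> carrier G \<times> X"
    using shift_X letter_in_carrier by (auto simp: T_simp)
next
  fix p assume "p \<in> carrier G \<times> X"
  then obtain g x where p: "p = (g, shift_map x)" "g \<in> carrier G" "x \<in> X"
    using shift_X by force
  \<comment> \<open>The first coordinate of the preimage is obtained by undoing the right
    multiplication by \<open>\<phi> [x 0]\<close>.\<close>
  then have "p = T (g \<otimes> inv (\<phi> [x 0]), x)"
    using letter_in_carrier by (simp add: T_simp m_assoc)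
  then show "p \<in> T ` (carrier G \<times> X)"
    using p letter_in_carrier by blast
qed

lemma closed_invariant_subset: "closed_invariant \<T> T Z \<Longrightarrow> Z \<subseteq> carrier G \<times> X"
  using closedin_subset topspace_skew by (fastforce simp: closed_invariant_def)

text \<open>Injectivity of \<open>T\<close> turns invariance under images, as in
  \<open>closed_invariant\<close>, into invariance under preimages, as in
  \<open>ergodic_measure\<close>.\<close>

lemma closed_invariant_vimage:
  assumes Z: "closed_invariant \<T> T Z" and "Z \<subseteq> Y" "Y \<subseteq> carrier G \<times> X"
  shows "T -` Z \<inter> Y = Z"
proof -
  have TZ: "T ` Z = Z" using Z by (simp add: closed_invariant_def)
  have "p \<in> Z" if p: "T p \<in> Z" "p \<in> Y" for p
  proof -
    obtain q where "q \<in> Z" "T p = T q" using p TZ by (metis imageE)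
    moreover have "p \<in> carrier G \<times> X" "q \<in> carrier G \<times> X"
      using p \<open>q \<in> Z\<close> assms by blast+
    ultimately have "p = q"
      using inj_onD[OF T_inj] by blast
    then show ?thesis using \<open>q \<in> Z\<close> by simp
  qed
  then show ?thesis using TZ assms by auto
qed

text \<open>An injective map commutes with intersections. This allows a minimal set to be compared
  with any closed invariant set that meets it.\<close>

lemma closed_invariant_Int:
  assumes "closed_invariant \<T> T Y" "closed_invariant \<T> T Z"
  shows "closed_invariant \<T> T (Y \<inter> Z)"
  using assms inj_on_image_Int[OF T_inj, of Y Z] closed_invariant_subset
  by (auto simp: closed_invariant_def)

section \<open>Fibers of closed invariant sets and the constancy of their size\<close>

lemma fiber_subset: "Z \<subseteq> carrier G \<times> X \<Longrightarrow> fiber Z x \<subseteq> carrier G"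
  by (auto simp: fiber_def)

lemma closedin_slice:
  assumes "closedin \<T> Z" and g: "g \<in> carrier G"
  shows "closedin (subtopology (full_shift A) X) {x \<in> X. (g, x) \<in> Z}"
proof -
  have "continuous_map (subtopology (full_shift A) X) \<T> (\<lambda>x. (g, x))"
    unfolding skew_topology_def using g by (intro continuous_map_pairedI) auto
  from closedin_continuous_map_preimage[OF this assms(1)] show ?thesis
    by (simp only: topspace_subtopology_X)
qed

text \<open>Because the shift is injective, every point of \<open>Z\<close> above
  \<open>shift_map x\<close> is the image of a point of \<open>Z\<close> above
  \<open>x\<close>.\<close>

lemma fiber_shift:
  assumes Z: "closed_invariant \<T> T Z" and x: "x \<in> X"
  shows "fiber Z (shift_map x) = (\<lambda>g. g \<otimes> \<phi> [x 0]) ` fiber Z x"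
proof (intro equalityI subsetI)
  have TZ: "T ` Z = Z" using Z by (simp add: closed_invariant_def)
  fix g
  {
    assume "g \<in> fiber Z (shift_map x)"
    then have "(g, shift_map x) \<in> T ` Z" by (simp add: fiber_def TZ)
    then obtain h y where h: "(h, y) \<in> Z" "(g, shift_map x) = T (h, y)" by auto
    moreover have "x = y"
      using h(2) injD[OF inj_shift_map, of x y] by (simp add: T_simp)
    ultimately show "g \<in> (\<lambda>g. g \<otimes> \<phi> [x 0]) ` fiber Z x"
      by (auto simp: fiber_def T_simp)
  next
    assume "g \<in> (\<lambda>g. g \<otimes> \<phi> [x 0]) ` fiber Z x"
    then obtain h where "(h, x) \<in> Z" "g = h \<otimes> \<phi> [x 0]" by (auto simp: fiber_def)
    then have "(g, shift_map x) \<in> T ` Z" by (force simp: T_simp)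
    then show "g \<in> fiber Z (shift_map x)" by (simp add: TZ fiber_def)
  }
qed

lemma card_fiber_shift:
  assumes Z: "closed_invariant \<T> T Z" and x: "x \<in> X"
  shows "card (fiber Z (shift_map x)) = card (fiber Z x)"
proof -
  have "inj_on (\<lambda>g. g \<otimes> \<phi> [x 0]) (fiber Z x)"
    using letter_in_carrier[OF x] fiber_subset[OF closed_invariant_subset[OF Z], of x]
    by (intro inj_onI) (metis in_mono right_cancel)
  then show ?thesis
    by (simp add: fiber_shift[OF Z x] card_image)
qed

text \<open>Upper semicontinuity of the fiber size: a fiber has at least \<open>k\<close> elements
  iff it contains some \<open>k\<close>-element subset \<open>S\<close> of the group. There are
  finitely many such \<open>S\<close>, and each gives an intersection of closed slices.\<close>

lemma closedin_card_fiber_ge: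
  assumes "closedin \<T> Z"
  shows "closedin (full_shift A) {x \<in> X. k \<le> card (fiber Z x)}"
proof -
  have sub: "Z \<subseteq> carrier G \<times> X"
    using closedin_subset[OF assms] topspace_skew by simp
  have fin: "finite (fiber Z x)" for x
    using fiber_subset[OF sub] finite_carrier finite_subset by blast
  let ?F = "{S. S \<subseteq> carrier G \<and> card S = k}"
  \<comment> \<open>Inserting \<open>X\<close> keeps the intersection inside \<open>X\<close> when
    \<open>S\<close> is empty, that is, when \<open>k\<close> is 0.\<close>
  let ?C = "\<lambda>S. \<Inter> (insert X ((\<lambda>g. {x \<in> X. (g, x) \<in> Z}) ` S))"
  have "closedin (full_shift A) (\<Union> (?C ` ?F))"
  proof (rule closedin_Union)
    show "finite (?C ` ?F)" using finite_carrier by auto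
    fix C assume "C \<in> ?C ` ?F"
    then obtain S where S: "S \<subseteq> carrier G" and C: "C = ?C S" by blast
    have "closedin (full_shift A) {x \<in> X. (g, x) \<in> Z}" if "g \<in> S" for g
      using closedin_trans_full[OF closedin_slice[OF assms] closed_X] S that by blast
    then show "closedin (full_shift A) C"
      unfolding C using closed_X by (intro closedin_Inter) auto
  qed
  moreover have "\<Union> (?C ` ?F) = {x \<in> X. k \<le> card (fiber Z x)}"
  proof (intro equalityI subsetI)
    fix x assume "x \<in> \<Union> (?C ` ?F)"
    then obtain S where S: "S \<in> ?F" "x \<in> ?C S" by blast
    then have "S \<subseteq> fiber Z x" "x \<in> X" by (auto simp: fiber_def)
    then show "x \<in> {x \<in> X. k \<le> card (fiber Z x)}"
      using S card_mono[OF fin] by auto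
  next
    fix x assume x: "x \<in> {x \<in> X. k \<le> card (fiber Z x)}"
    then obtain S where S: "S \<subseteq> fiber Z x" "card S = k"
      using obtain_subset_with_card_n by blast
    then have "S \<in> ?F" using fiber_subset[OF sub] by blast
    moreover have "x \<in> ?C S" using S x by (auto simp: fiber_def)
    ultimately show "x \<in> \<Union> (?C ` ?F)" by blast
  qed
  ultimately show ?thesis by simp
qed

text \<open>The points whose fiber is at least as large as that of \<open>x\<close> form a closed
  shift-invariant set containing \<open>x\<close>. By minimality it is all of \<open>X\<close>;
  exchanging \<open>x\<close> and \<open>y\<close> gives equality.\<close>

lemma card_fiber_constant:
  assumes Z: "closed_invariant \<T> T Z" and x: "x \<in> X" and y: "y \<in> X"
  shows "card (fiber Z x) = card (fiber Z y)"
proof -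
  have le: "card (fiber Z x) \<le> card (fiber Z y)" if x: "x \<in> X" and y: "y \<in> X" for x y
  proof -
    let ?E = "{z \<in> X. card (fiber Z x) \<le> card (fiber Z z)}"
    have "closedin (full_shift A) ?E"
      using Z by (intro closedin_card_fiber_ge) (simp add: closed_invariant_def)
    moreover have "shift_map ` ?E = ?E"
    proof (intro equalityI subsetI)
      fix z assume "z \<in> shift_map ` ?E"
      then show "z \<in> ?E" using shift_X card_fiber_shift[OF Z] by auto
    next
      fix z assume z: "z \<in> ?E"
      then obtain w where "w \<in> X" "z = shift_map w" using shift_X by blast
      then show "z \<in> shift_map ` ?E" using z card_fiber_shift[OF Z] by auto
    qed
    ultimately have "?E = X" using x by (intro minimal_X) auto
    then show ?thesis using y by blast
  qed
  show ?thesis using le[OF x y] le[OF y x] by simp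
qed

text \<open>One point of \<open>Z\<close> makes one fiber nonempty, and all fibers have the same
  size. Thus \<open>Z\<close> projects onto \<open>X\<close>.\<close>

lemma card_fiber_pos:
  assumes Z: "closed_invariant \<T> T Z" "Z \<noteq> {}" and x: "x \<in> X"
  shows "card (fiber Z x) > 0"
proof -
  obtain g y where gy: "(g, y) \<in> Z" using Z by auto
  then have y: "y \<in> X" using closed_invariant_subset[OF Z(1)] by auto
  have "finite (fiber Z y)"
    using finite_subset[OF fiber_subset[OF closed_invariant_subset[OF Z(1)]] finite_carrier] .
  moreover have "g \<in> fiber Z y" using gy by (simp add: fiber_def)
  ultimately have "card (fiber Z y) > 0" using card_gt_0_iff by blast
  then show ?thesis using card_fiber_constant[OF Z(1) x y] by simp
qed

section \<open>The product measure and its values on closed invariant sets\<close>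

lemma space_m: "space m = carrier G \<times> X"
  by (simp add: skew_measure_def space_pair_measure space_uniform_count_measure space_\<mu>)

lemma sets_m: "sets m = sets (count_space (carrier G) \<Otimes>\<^sub>M \<mu>)"
  unfolding skew_measure_def
  by (intro sets_pair_measure_cong) (auto simp: uniform_count_measure_def sets_point_measure)

text \<open>A closed set is the finite union over \<open>g\<close> of the measurable rectangles
  formed by \<open>{g}\<close> and its closed slice at \<open>g\<close>.\<close>

lemma closed_in_sets_m:
  assumes "closedin \<T> Z"
  shows "Z \<in> sets m"
proof -
  have "Z \<subseteq> carrier G \<times> X"
    using closedin_subset[OF assms] topspace_skew by simp
  then have "Z = (\<Union>g\<in>carrier G. {g} \<times> {x \<in> X. (g, x) \<in> Z})" by auto
  moreover have "{g} \<times> {x \<in> X. (g, x) \<in> Z} \<in> sets m" if "g \<in> carrier G" for g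
    unfolding sets_m
    using closed_in_sets_borel_of[OF closedin_slice[OF assms that]] that
    by (intro pair_measureI) (auto simp: sets_\<mu>)
  ultimately show ?thesis
    using finite_carrier by (metis (no_types, lifting) sets.finite_UN)
qed

lemma closed_invariant_in_sets_m: "closed_invariant \<T> T Z \<Longrightarrow> Z \<in> sets m"
  by (simp add: closed_in_sets_m closed_invariant_def)

lemma slice_in_sets: "B \<in> sets m \<Longrightarrow> Pair g -` B \<in> sets \<mu>"
  unfolding skew_measure_def by (rule sets_Pair1)

lemma card_carrier_pos: "card (carrier G) > 0"
  using finite_carrier one_closed card_gt_0_iff by blast

text \<open>By Fubini the measure is the integral of the slice measures, and for the uniform measure
  on the group this integral is an average.\<close>

lemma emeasure_m:
  assumes "B \<in> sets m"
  shows "emeasure m B = (\<Sum>g\<in>carrier G. emeasure \<mu> (Pair g -` B)) / of_nat (card (carrier G))"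
proof -
  have "emeasure m B = (\<integral>\<^sup>+g. emeasure \<mu> (Pair g -` B) \<partial>uniform_count_measure (carrier G))"
    using assms unfolding skew_measure_def by (rule \<mu>.emeasure_pair_measure_alt)
  also have "\<dots> = (\<Sum>g\<in>carrier G. ennreal (1 / card (carrier G)) * emeasure \<mu> (Pair g -` B))"
    using finite_carrier by (simp add: uniform_count_measure_def nn_integral_point_measure_finite)
  also have "\<dots> = ennreal (1 / card (carrier G)) * (\<Sum>g\<in>carrier G. emeasure \<mu> (Pair g -` B))"
    by (simp add: sum_distrib_left)
  also have "ennreal (1 / card (carrier G)) = 1 / of_nat (card (carrier G))"
    using card_carrier_pos by (simp add: divide_ennreal[symmetric] ennreal_of_nat_eq_real_of_nat)
  finally show ?thesis
    by (simp add: ennreal_divide_times)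
qed

text \<open>After exchanging sum and integral, the integrand at \<open>y\<close> counts the elements
  of the fiber above \<open>y\<close>. This count is constant on \<open>X\<close> and
  \<open>\<mu>\<close> has total mass 1.\<close>

lemma emeasure_closed_invariant:
  assumes Z: "closed_invariant \<T> T Z" and x: "x \<in> X"
  shows "emeasure m Z = of_nat (card (fiber Z x)) / of_nat (card (carrier G))"
proof -
  note [measurable] = slice_in_sets[OF closed_invariant_in_sets_m[OF Z]]
  have "(\<Sum>g\<in>carrier G. emeasure \<mu> (Pair g -` Z))
      = (\<integral>\<^sup>+y. (\<Sum>g\<in>carrier G. indicator (Pair g -` Z) y) \<partial>\<mu>)"
    by (subst nn_integral_sum) auto
  also have "\<dots> = (\<integral>\<^sup>+y. of_nat (card (fiber Z x)) \<partial>\<mu>)"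
  proof (rule nn_integral_cong)
    fix y assume "y \<in> space \<mu>"
    then have y: "y \<in> X" by (simp add: space_\<mu>)
    have "fiber Z y = {g \<in> carrier G. y \<in> Pair g -` Z}"
      using closed_invariant_subset[OF Z] by (auto simp: fiber_def)
    moreover have "(\<Sum>g\<in>carrier G. indicator (Pair g -` Z) y :: ennreal)
        = of_nat (card {g \<in> carrier G. y \<in> Pair g -` Z})"
      using finite_carrier by (simp add: indicator_def sum.If_cases Int_def)
    ultimately show "(\<Sum>g\<in>carrier G. indicator (Pair g -` Z) y)
        = (of_nat (card (fiber Z x)) :: ennreal)"
      using card_fiber_constant[OF Z x y] by simp
  qed
  also have "\<dots> = of_nat (card (fiber Z x))"
    by (simp add: \<mu>.emeasure_space_1)
  finally show ?thesis
    using emeasure_m[OF closed_invariant_in_sets_m[OF Z]] by simp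
qed

lemma prob_space_m: "prob_space m"
proof
  have "(\<Sum>g\<in>carrier G. emeasure \<mu> (Pair g -` space m)) = (\<Sum>g\<in>carrier G. 1)"
  proof (intro sum.cong refl)
    fix g assume "g \<in> carrier G"
    then have "Pair g -` space m = space \<mu>" by (auto simp: space_m space_\<mu>)
    then show "emeasure \<mu> (Pair g -` space m) = 1" by (simp add: \<mu>.emeasure_space_1)
  qed
  then show "emeasure m (space m) = 1"
    using emeasure_m[OF sets.top] card_carrier_pos by (simp add: ennreal_of_nat_eq_real_of_nat divide_ennreal)
qed

sublocale m: prob_space m by (rule prob_space_m)

text \<open>Equal measures force fibers of equal size above every point, and a subset of a finite
  set with the same cardinality is the whole set.\<close>

lemma closed_invariant_eqI:
  assumes Y: "closed_invariant \<T> T Y" and Z: "closed_invariant \<T> T Z"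
    and "Z \<subseteq> Y" and eq: "emeasure m Z = emeasure m Y"
  shows "Z = Y"
proof -
  have "fiber Z x = fiber Y x" if x: "x \<in> X" for x
  proof (rule card_subset_eq)
    show "finite (fiber Y x)"
      using finite_subset[OF fiber_subset[OF closed_invariant_subset[OF Y]] finite_carrier] .
    show "fiber Z x \<subseteq> fiber Y x" using \<open>Z \<subseteq> Y\<close> by (auto simp: fiber_def)
    have "(of_nat (card (fiber Z x)) / of_nat (card (carrier G)) :: ennreal)
        = of_nat (card (fiber Y x)) / of_nat (card (carrier G))"
      using eq emeasure_closed_invariant[OF Y x] emeasure_closed_invariant[OF Z x] by simp
    \<comment> \<open>The equation is moved to the reals in order to cancel the common positive
      denominator.\<close>
    then have "ennreal (real (card (fiber Z x)) / real (card (carrier G)))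
        = ennreal (real (card (fiber Y x)) / real (card (carrier G)))"
      using card_carrier_pos by (simp add: ennreal_of_nat_eq_real_of_nat divide_ennreal)
    then show "card (fiber Z x) = card (fiber Y x)"
      using card_carrier_pos by simp
  qed
  then show ?thesis
    using \<open>Z \<subseteq> Y\<close> closed_invariant_subset[OF Y] by (fastforce simp: fiber_def)
qed

lemma emeasure_closed_invariant_nonzero:
  assumes Z: "closed_invariant \<T> T Z" "Z \<noteq> {}"
  shows "emeasure m Z \<noteq> 0"
proof -
  obtain x where x: "x \<in> X" using X_nonempty by auto
  show ?thesis
    using emeasure_closed_invariant[OF Z(1) x] card_fiber_pos[OF Z x]
    by (auto simp: ennreal_divide_eq_0_iff)
qed

section \<open>From ergodicity to minimality\<close>

lemma ergodic_restriction_minimal: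
  assumes Y: "closed_invariant \<T> T Y" and erg: "restricts_to_ergodic m T Y"
  shows "minimal_closed_invariant \<T> T Y"
  unfolding minimal_closed_invariant_def
proof (intro conjI allI impI Y)
  show "Y \<noteq> {}" using erg by (auto simp: restricts_to_ergodic_def)
  fix Z assume Z: "closed_invariant \<T> T Z \<and> Z \<noteq> {} \<and> Z \<subseteq> Y"
  \<comment> \<open>The first alternative is impossible since nonempty closed invariant sets have
    positive measure; the second forces \<open>Z = Y\<close>.\<close>
  then have "emeasure m Z = 0 \<or> emeasure m Z = emeasure m Y"
    using closed_invariant_vimage closed_invariant_subset[OF Y] closed_invariant_in_sets_m Y
      m.finite_measure_axioms
    by (intro ergodic_restriction_full_or_null[OF erg]) auto
  then show "Z = Y"
    using Z emeasure_closed_invariant_nonzero closed_invariant_eqI[OF Y] by blast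
qed

lemma closed_invariant_whole: "closed_invariant \<T> T (carrier G \<times> X)"
  using T_surj closedin_topspace[of \<T>] by (simp add: closed_invariant_def topspace_skew)

text \<open>The argument for a restriction, applied directly to the whole space: a nonempty closed
  invariant set is not null, so it has full measure and contains every fiber.\<close>

lemma ergodic_minimal:
  assumes erg: "ergodic_measure m T"
  shows "minimal_closed_invariant \<T> T (carrier G \<times> X)"
  unfolding minimal_closed_invariant_def
proof (intro conjI allI impI closed_invariant_whole)
  show "carrier G \<times> X \<noteq> {}" using X_nonempty one_closed by blast
  fix Z assume Z: "closed_invariant \<T> T Z \<and> Z \<noteq> {} \<and> Z \<subseteq> carrier G \<times> X"
  then have "measure m Z = 0 \<or> measure m Z = 1"
    using erg closed_invariant_vimage[of Z "carrier G \<times> X"] closed_invariant_in_sets_m[of Z]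
    by (auto simp: ergodic_measure_def space_m)
  then have "emeasure m Z = emeasure m (carrier G \<times> X)"
    using Z emeasure_closed_invariant_nonzero[of Z] m.emeasure_space_1
    by (auto simp: m.emeasure_eq_measure space_m)
  then show "Z = carrier G \<times> X"
    using Z closed_invariant_eqI[OF closed_invariant_whole] by blast
qed

section \<open>Left translations as symmetries of the skew product\<close>

lemma L_closed: "h \<in> carrier G \<Longrightarrow> p \<in> carrier G \<times> X \<Longrightarrow> L h p \<in> carrier G \<times> X"
  by (auto simp: L_simp)

lemma L_inverse:
  assumes "h \<in> carrier G" "p \<in> carrier G \<times> X"
  shows "L h (L (inv h) p) = p" "L (inv h) (L h p) = p"
  using assms by (auto simp: L_simp m_assoc[symmetric])

lemma L_T_commute:
  assumes "h \<in> carrier G" "p \<in> carrier G \<times> X"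
  shows "T (L h p) = L h (T p)"
  using assms letter_in_carrier by (auto simp: L_simp T_simp m_assoc)

lemma L_continuous: "h \<in> carrier G \<Longrightarrow> continuous_map \<T> \<T> (L h)"
  unfolding skew_topology_def left_translation_def case_prod_unfold
  by (intro continuous_map_pairedI continuous_map_snd
      continuous_map_compose[OF continuous_map_fst, unfolded o_def, where g = "\<lambda>g. h \<otimes> g"]) auto

text \<open>Translations by \<open>h\<close> and \<open>inv h\<close> are mutually inverse. Writing
  an image as a preimage lets continuity of the inverse translation show that translates of closed
  sets are closed.\<close>

lemma L_image_vimage:
  assumes h: "h \<in> carrier G" and "Z \<subseteq> carrier G \<times> X"
  shows "L h ` Z = L (inv h) -` Z \<inter> (carrier G \<times> X)"
proof (intro equalityI subsetI)
  fix p assume "p \<in> L h ` Z"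
  then show "p \<in> L (inv h) -` Z \<inter> (carrier G \<times> X)"
    using assms L_inverse(2)[OF h] L_closed[OF h] by fastforce
next
  fix p assume "p \<in> L (inv h) -` Z \<inter> (carrier G \<times> X)"
  then show "p \<in> L h ` Z"
    using L_inverse(1)[OF h, of p] by (intro image_eqI[of _ _ "L (inv h) p"]) auto
qed

lemma closed_invariant_L:
  assumes h: "h \<in> carrier G" and Z: "closed_invariant \<T> T Z"
  shows "closed_invariant \<T> T (L h ` Z)"
proof -
  have sub: "Z \<subseteq> carrier G \<times> X" by (rule closed_invariant_subset[OF Z])
  have "closedin \<T> {p \<in> topspace \<T>. L (inv h) p \<in> Z}"
    using Z h by (intro closedin_continuous_map_preimage[OF L_continuous])
      (auto simp: closed_invariant_def)
  then have "closedin \<T> (L h ` Z)"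
    by (simp add: L_image_vimage[OF h sub] topspace_skew vimage_def Int_def conj_commute)
  moreover have "T ` L h ` Z = L h ` T ` Z"
    using L_T_commute[OF h] sub by (auto simp: image_image intro!: image_cong)
  ultimately show ?thesis using Z by (simp add: closed_invariant_def)
qed

text \<open>Both sets project onto \<open>X\<close>, so they have points above a common
  \<open>x\<close>, and some left translation carries one point to the other. The translate of
  \<open>Y\<close> then meets \<open>Y'\<close>, and minimality of the two sets gives the two
  inclusions.\<close>

lemma minimal_eq_translate:
  assumes Y: "minimal_closed_invariant \<T> T Y" and Y': "minimal_closed_invariant \<T> T Y'"
  shows "\<exists>h\<in>carrier G. Y' = L h ` Y"
proof -
  have cY: "closed_invariant \<T> T Y" "Y \<noteq> {}" and cY': "closed_invariant \<T> T Y'" "Y' \<noteq> {}"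
    using Y Y' by (auto simp: minimal_closed_invariant_def)
  have sub: "Y \<subseteq> carrier G \<times> X" "Y' \<subseteq> carrier G \<times> X"
    using cY cY' closed_invariant_subset by auto
  obtain g' x where g': "(g', x) \<in> Y'" using cY' by auto
  then have x: "x \<in> X" "g' \<in> carrier G" using sub by auto
  obtain g where g: "(g, x) \<in> Y"
    using card_fiber_pos[OF cY x(1)] by (auto simp: fiber_def card_gt_0_iff)
  then have gG: "g \<in> carrier G" using sub by auto
  \<comment> \<open>This is the element whose left translation sends \<open>(g, x)\<close> to
    \<open>(g', x)\<close>.\<close>
  define h where "h = g' \<otimes> inv g"
  have h: "h \<in> carrier G" using x gG by (simp add: h_def)
  have "L h (g, x) = (g', x)" using x gG by (simp add: h_def L_simp m_assoc)
  then have meet: "(g', x) \<in> L h ` Y \<inter> Y'" using g g' by force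
  have cL: "closed_invariant \<T> T (L h ` Y)" by (rule closed_invariant_L[OF h cY(1)])
  have "L h ` Y \<inter> Y' = Y'"
    using Y' meet closed_invariant_Int[OF cL cY'(1)]
    unfolding minimal_closed_invariant_def by blast
  then have le: "Y' \<subseteq> L h ` Y" by blast
  have hi: "inv h \<in> carrier G" using h by simp
  \<comment> \<open>Translating the inclusion back gives a nonempty closed invariant subset of
    \<open>Y\<close>, to which minimality of \<open>Y\<close> applies.\<close>
  have "L (inv h) ` Y' \<subseteq> Y"
  proof
    fix p assume "p \<in> L (inv h) ` Y'"
    then obtain q where q: "q \<in> Y" "p = L (inv h) (L h q)" using le by blast
    then have "p = q" using L_inverse(2)[OF h, of q] sub by blast
    then show "p \<in> Y" using q by simp
  qed
  then have eq: "L (inv h) ` Y' = Y"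
    using Y cY' closed_invariant_L[OF hi cY'(1)] unfolding minimal_closed_invariant_def by blast
  have "L h ` Y \<subseteq> Y'"
  proof
    fix p assume "p \<in> L h ` Y"
    then obtain q where q: "q \<in> Y'" "p = L h (L (inv h) q)" using eq by blast
    then have "p = q" using L_inverse(1)[OF h, of q] sub by blast
    then show "p \<in> Y'" using q by simp
  qed
  with le h show ?thesis by blast
qed

lemma L_measurable:
  assumes h: "h \<in> carrier G"
  shows "L h \<in> m \<rightarrow>\<^sub>M m"
proof -
  have "(\<lambda>g. h \<otimes> g) \<in> count_space (carrier G) \<rightarrow>\<^sub>M count_space (carrier G)"
    using h by auto
  then have "(\<lambda>p. (h \<otimes> fst p, snd p))
      \<in> count_space (carrier G) \<Otimes>\<^sub>M \<mu> \<rightarrow>\<^sub>M count_space (carrier G) \<Otimes>\<^sub>M \<mu>"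
    by (intro measurable_Pair measurable_compose[OF measurable_fst] measurable_snd)
  then show ?thesis
    by (simp add: measurable_cong_sets[OF sets_m sets_m] left_translation_def case_prod_unfold)
qed

text \<open>The slice at \<open>g\<close> of the preimage of \<open>B\<close> is the slice of
  \<open>B\<close> at \<open>h \<otimes> g\<close>. Left multiplication permutes the group, so the
  average of the slice measures is merely reindexed.\<close>

lemma L_distr:
  assumes h: "h \<in> carrier G"
  shows "distr m m (L h) = m"
proof (rule measure_eqI)
  fix B assume "B \<in> sets (distr m m (L h))"
  then have B: "B \<in> sets m" by simp
  let ?C = "L h -` B \<inter> space m"
  have C: "?C \<in> sets m" using L_measurable[OF h] B by (rule measurable_sets)
  have "B \<subseteq> carrier G \<times> X" using sets.sets_into_space[OF B] space_m by simp
  then have slice: "Pair g -` ?C = Pair (h \<otimes> g) -` B" if "g \<in> carrier G" for g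
    using that by (auto simp: L_simp space_m)
  have bij: "bij_betw (\<lambda>g. h \<otimes> g) (carrier G) (carrier G)"
    using h by (intro bij_betw_byWitness[where f' = "\<lambda>g. inv h \<otimes> g"])
      (auto simp: m_assoc[symmetric])
  have "(\<Sum>g\<in>carrier G. emeasure \<mu> (Pair g -` ?C))
      = (\<Sum>g\<in>carrier G. emeasure \<mu> (Pair (h \<otimes> g) -` B))"
    by (intro sum.cong refl) (simp only: slice)
  also have "\<dots> = (\<Sum>g\<in>carrier G. emeasure \<mu> (Pair g -` B))"
    by (rule sum.reindex_bij_betw[OF bij])
  finally have "emeasure m ?C = emeasure m B"
    by (simp only: emeasure_m[OF B] emeasure_m[OF C])
  then show "emeasure (distr m m (L h)) B = emeasure m B"
    by (simp add: emeasure_distr[OF L_measurable[OF h] B])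
qed simp

text \<open>The minimal set \<open>Y'\<close> is a left translate of \<open>Y\<close>, and
  translations preserve the measure and commute with \<open>T\<close>, so ergodicity is transported
  from \<open>Y\<close> to \<open>Y'\<close>.\<close>

lemma ergodic_restriction_all_minimal:
  assumes Y: "minimal_closed_invariant \<T> T Y" and erg: "restricts_to_ergodic m T Y"
    and Y': "minimal_closed_invariant \<T> T Y'"
  shows "restricts_to_ergodic m T Y'"
proof -
  obtain h where h: "h \<in> carrier G" and eq: "Y' = L h ` Y"
    using minimal_eq_translate[OF Y Y'] by blast
  have cY: "closed_invariant \<T> T Y" "closed_invariant \<T> T Y'"
    using Y Y' by (auto simp: minimal_closed_invariant_def)
  have hi: "inv h \<in> carrier G" using h by simp
  have "L (inv h) ` Y' = Y"
    using L_inverse(2)[OF h] closed_invariant_subset[OF cY(1)] by (force simp: eq image_image)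
  \<comment> \<open>Here the image under the translation by \<open>inv h\<close> is rewritten as a
    preimage under the translation by \<open>inv (inv h) = h\<close>.\<close>
  then have "L h -` Y' \<inter> space m = Y"
    using L_image_vimage[OF hi closed_invariant_subset[OF cY(2)]] h by (simp add: space_m)
  then show ?thesis
    using cY h hi L_inverse(1) L_T_commute
    by (intro restricts_to_ergodic_transfer[OF erg, where L = "L h" and K = "L (inv h)"])
      (auto simp: closed_invariant_in_sets_m L_measurable L_distr m.finite_measure_axioms space_m)
qed

end

section \<open>Ergodic restrictions and minimality for group extensions of minimal shifts\<close>

theorem corollary7p2:
  fixes A :: "'a set" and X :: "(int \<Rightarrow> 'a) set" and \<mu> :: "(int \<Rightarrow> 'a) measure"
    and G :: "('g, 'b) monoid_scheme" and \<phi> :: "'a list \<Rightarrow> 'g"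
  assumes "finite A"
    and "minimal_shift_space A X"
    and "sets \<mu> = sets (borel_of (subtopology (full_shift A) X))"
    and "invariant_measure \<mu> shift_map"
    and "group G" and "finite (carrier G)"
    and "\<phi> \<in> epi (free_monoid A) G" and "\<phi> [] = \<one>\<^bsub>G\<^esub>"
  shows
    "(\<forall>Y. closed_invariant (skew_topology G A X) (skew_map G \<phi>) Y \<and>
          restricts_to_ergodic (skew_measure G \<mu>) (skew_map G \<phi>) Y \<longrightarrow>
          minimal_closed_invariant (skew_topology G A X) (skew_map G \<phi>) Y) \<and>
     ((\<exists>Y. minimal_closed_invariant (skew_topology G A X) (skew_map G \<phi>) Y \<and>
           restricts_to_ergodic (skew_measure G \<mu>) (skew_map G \<phi>) Y) \<longrightarrow>
      (\<forall>Y. minimal_closed_invariant (skew_topology G A X) (skew_map G \<phi>) Y \<longrightarrow>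
           restricts_to_ergodic (skew_measure G \<mu>) (skew_map G \<phi>) Y)) \<and>
     (ergodic_measure (skew_measure G \<mu>) (skew_map G \<phi>) \<longrightarrow>
      minimal_closed_invariant (skew_topology G A X) (skew_map G \<phi>) (carrier G \<times> X))"
proof -
  interpret group G by fact
  \<comment> \<open>One-letter words over \<open>A\<close> lie in the carrier of the free monoid,
    which the morphism maps into the group.\<close>
  have "\<phi> [a] \<in> carrier G" if "a \<in> A" for a
    using assms(7) that by (auto simp: epi_def hom_def free_monoid_def)
  then interpret minimal_skew_product G A X \<phi> \<mu>
    using assms by unfold_locales (auto simp: minimal_shift_space_def)
  show ?thesis
    using ergodic_restriction_minimal ergodic_restriction_all_minimal ergodic_minimal by blast
qed

end
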